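(* Let $n \ge 1$ and let $a_1 \le a_2 \le \dots \le a_n$ be integers with $a_1+\dots+a_j \le 0$ for $1 \le j \le n-1$ and $a_1+\dots+a_n \ge 1$. Let \[ L = \Bigl\{ \lambda \in \mathbb{Z}_{\ge 0}^n : \sum_{j=1}^n a_j \lambda_{\pi(j)} \ge 0 \text{ for all } \pi \in S_n \Bigr\}, \qquad F(z) = \sum_{\lambda \in L} z^{\lambda}. \] Define vectors $A_1,\dots,A_n \in \mathbb{Z}^n$ by: for $j<n$, the $i$-th coordinate of $A_j$ is $a_{j+1}+a_{j+2}+\dots+a_n$ if $i \le j$ and $-(a_1+\dots+a_j)$ if $i > j$; and $A_n = (1,1,\dots,1)$. Let $\Pi = \{\sum_{j=1}^n c_j A_j : 0 \le c_j < 1\}$. Then \[ F(z) = \sum_{p \in \Pi \cap \mathbb{Z}^n} \sum_{\pi \in S_n} \frac{z_\pi^{\,p} \prod_{i \in D_\pi,\ p_i = p_{i+1}} z_\pi^{\,A_i}}{\prod_{j=1}^n \bigl(1 - z_\pi^{\,A_j}\bigr)}, \] where the product in the numerator is over all descent positions $i$ of $\pi$ for which the $i$-th and $(i+1)$-st coordinates of $p$ are equal.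
   Context: $z=(z_1,\dots,z_n)$; for $b \in \mathbb{Z}^n$, $z^b = z_1^{b_1}\cdots z_n^{b_n}$. For $\pi \in S_n$, $z_\pi = (z_{\pi(1)},\dots,z_{\pi(n)})$, so $z_\pi^{\,b} = z_{\pi(1)}^{b_1}\cdots z_{\pi(n)}^{b_n}$. The descent set of $\pi$ is $D_\pi=\{j\in\{1,\dots,n-1\}:\pi(j)>\pi(j+1)\}$. Generating functions are formal power series. *)

theory Defs
  imports Complex_Main "HOL-Library.Poly_Mapping" "HOL-Library.FuncSet"
    "HOL-Combinatorics.Permutations"
begin

text \<open>
  Power series in variables indexed by \<open>nat\<close>, given by their coefficient functions on
  finitely supported exponent vectors. The series in the variables with indices \<open>1, \<dots>, n\<close> form
  a subring.
\<close>

typedef 'a mfps = "UNIV :: ((nat \<Rightarrow>\<^sub>0 nat) \<Rightarrow> 'a) set"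
  morphisms mfps_nth Abs_mfps ..

setup_lifting type_definition_mfps

lemma mfps_eqI: "(\<And>m. mfps_nth f m = mfps_nth g m) \<Longrightarrow> f = g"
  by transfer auto

definition expo_splits :: "(nat \<Rightarrow>\<^sub>0 nat) \<Rightarrow> ((nat \<Rightarrow>\<^sub>0 nat) \<times> (nat \<Rightarrow>\<^sub>0 nat)) set" where
  "expo_splits m = {(u, v). u + v = m}"

lemma finite_expo_splits [simp]: "finite (expo_splits m)"
proof -
  define K where "K = Poly_Mapping.keys m"
  define N where "N = Max (Poly_Mapping.lookup m ` K)"
  define B where "B = {f. \<forall>i. (i \<in> K \<longrightarrow> f i \<in> {..N}) \<and> (i \<notin> K \<longrightarrow> f i = (0::nat))}"
  have "finite K" by (simp add: K_def)
  then have "finite B"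
    unfolding B_def by (rule finite_set_of_finite_funs) simp
  have *: "Poly_Mapping.lookup u \<in> B" if "u + v = m" for u v
  proof -
    have le: "Poly_Mapping.lookup u i \<le> Poly_Mapping.lookup m i" for i
      unfolding that [symmetric] lookup_add by simp
    have "Poly_Mapping.lookup u i \<le> N" if "i \<in> K" for i
      unfolding N_def using le [of i] that \<open>finite K\<close>
      by (intro order_trans [OF _ Max_ge]) auto
    moreover have "Poly_Mapping.lookup u i = 0" if "i \<notin> K" for i
      using le [of i] that by (simp add: K_def in_keys_iff)
    ultimately show ?thesis by (simp add: B_def)
  qed
  have "(\<lambda>(u, v). (Poly_Mapping.lookup u, Poly_Mapping.lookup v)) ` expo_splits m \<subseteq> B \<times> B"
    using * by (auto simp: expo_splits_def) (metis add.commute)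
  moreover have "inj_on (\<lambda>(u, v). (Poly_Mapping.lookup u, Poly_Mapping.lookup v)) (expo_splits m)"
    by (auto intro!: inj_onI simp: lookup_inject)
  ultimately show ?thesis
    using \<open>finite B\<close> by (meson finite_SigmaI finite_imageD finite_subset)
qed

instantiation mfps :: (comm_ring_1) comm_ring_1
begin

lift_definition zero_mfps :: "'a mfps" is "\<lambda>_. 0" .
lift_definition one_mfps :: "'a mfps" is "\<lambda>m. if m = 0 then 1 else 0" .
lift_definition plus_mfps :: "'a mfps \<Rightarrow> 'a mfps \<Rightarrow> 'a mfps" is "\<lambda>f g m. f m + g m" .
lift_definition minus_mfps :: "'a mfps \<Rightarrow> 'a mfps \<Rightarrow> 'a mfps" is "\<lambda>f g m. f m - g m" .
lift_definition uminus_mfps :: "'a mfps \<Rightarrow> 'a mfps" is "\<lambda>f m. - f m" .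
lift_definition times_mfps :: "'a mfps \<Rightarrow> 'a mfps \<Rightarrow> 'a mfps" is
  "\<lambda>f g m. \<Sum>(u, v)\<in>expo_splits m. f u * g v" .

instance
proof
  fix f g h :: "'a mfps"
  show "f * g * h = f * (g * h)"
  proof (rule mfps_eqI)
    fix m
    have "mfps_nth (f * g * h) m =
      (\<Sum>(x, c)\<in>expo_splits m. \<Sum>(u, v)\<in>expo_splits x. mfps_nth f u * mfps_nth g v * mfps_nth h c)"
      by (simp add: times_mfps.rep_eq sum_distrib_right case_prod_beta)
    also have "\<dots> = (\<Sum>((x, c), (u, v))\<in>Sigma (expo_splits m) (\<lambda>(x, c). expo_splits x).
        mfps_nth f u * mfps_nth g v * mfps_nth h c)"
      by (subst sum.Sigma [symmetric]) (auto simp: case_prod_beta)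
    also have "\<dots> = (\<Sum>((u, y), (v, c))\<in>Sigma (expo_splits m) (\<lambda>(u, y). expo_splits y).
        mfps_nth f u * (mfps_nth g v * mfps_nth h c))"
      by (rule sum.reindex_bij_witness
          [where i = "\<lambda>((u, y), (v, c)). ((u + v, c), (u, v))"
             and j = "\<lambda>((x, c), (u, v)). ((u, v + c), (v, c))"])
        (auto simp: expo_splits_def ac_simps)
    also have "\<dots> = (\<Sum>(u, y)\<in>expo_splits m. \<Sum>(v, c)\<in>expo_splits y.
        mfps_nth f u * (mfps_nth g v * mfps_nth h c))"
      by (subst sum.Sigma [symmetric]) (auto simp: case_prod_beta)
    also have "\<dots> = mfps_nth (f * (g * h)) m"
      by (simp add: times_mfps.rep_eq sum_distrib_left case_prod_beta)
    finally show "mfps_nth (f * g * h) m = mfps_nth (f * (g * h)) m" .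
  qed
  show "f * g = g * f"
  proof (rule mfps_eqI)
    fix m
    show "mfps_nth (f * g) m = mfps_nth (g * f) m"
      unfolding times_mfps.rep_eq
      by (rule sum.reindex_bij_witness [where i = prod.swap and j = prod.swap])
        (auto simp: expo_splits_def ac_simps)
  qed
  show "1 * f = f"
  proof (rule mfps_eqI)
    fix m
    have "mfps_nth (1 * f) m = (\<Sum>(u, v)\<in>{(0, m)}. mfps_nth 1 u * mfps_nth f v)"
      unfolding times_mfps.rep_eq
      by (rule sum.mono_neutral_right [OF finite_expo_splits])
        (auto simp: expo_splits_def one_mfps.rep_eq split: if_splits)
    then show "mfps_nth (1 * f) m = mfps_nth f m"
      by (simp add: one_mfps.rep_eq)
  qed
  show "(f + g) * h = f * h + g * h"
    by (rule mfps_eqI)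
      (simp add: times_mfps.rep_eq plus_mfps.rep_eq algebra_simps sum.distrib case_prod_beta)
  show "(0 :: 'a mfps) \<noteq> 1"
    by transfer (auto dest: fun_cong [of _ _ 0])
qed (transfer; simp add: algebra_simps)+

end

text \<open>The inverse of a non-unit is \<open>0\<close>, as for univariate power series.\<close>

instantiation mfps :: (comm_ring_1) inverse
begin

definition inverse_mfps :: "'a mfps \<Rightarrow> 'a mfps" where
  "inverse (f :: 'a mfps) = (if f dvd 1 then (THE g. f * g = 1) else 0)"

definition divide_mfps :: "'a mfps \<Rightarrow> 'a mfps \<Rightarrow> 'a mfps" where
  "f div (g :: 'a mfps) = f * inverse g"

instance ..

end

lemma mfps_inverse_unique:
  fixes f g :: "'a::comm_ring_1 mfps"
  assumes "f * g = 1"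
  shows "inverse f = g"
proof -
  have "h = g" if "f * h = 1" for h
  proof -
    have "h = (f * g) * h" by (simp add: assms)
    also have "\<dots> = (f * h) * g" by (simp only: ac_simps)
    finally show ?thesis by (simp add: that)
  qed
  then have "(THE g. f * g = 1) = g"
    using assms by (intro the_equality)
  moreover have "f dvd 1"
    using assms by (intro dvdI [of _ _ g]) simp
  ultimately show ?thesis by (simp add: inverse_mfps_def)
qed

definition mfps_var :: "nat \<Rightarrow> 'a::comm_ring_1 mfps" where
  "mfps_var i = Abs_mfps (\<lambda>m. if m = Poly_Mapping.single i 1 then 1 else 0)"

text \<open>
  The formal sum of a family in which every monomial has a nonzero coefficient in only finitely
  many members.
\<close>

definition mfps_sum :: "('b \<Rightarrow> 'a::comm_ring_1 mfps) \<Rightarrow> 'b set \<Rightarrow> 'a mfps" where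
  "mfps_sum f S = Abs_mfps (\<lambda>m. \<Sum>x | x \<in> S \<and> mfps_nth (f x) m \<noteq> 0. mfps_nth (f x) m)"


text \<open>
  Vectors in \<open>\<int>\<^sup>n\<close> and \<open>\<real>\<^sup>n\<close> are extensional functions on \<open>{1..n}\<close>.
\<close>

text \<open>
  \<open>zpow n \<pi> b\<close> is \<open>z\<^sub>\<pi>\<close> to the power \<open>b\<close>; \<open>z\<close> itself is the case \<open>\<pi> = id\<close>. No variable is
  invertible as a power series, so the value is meaningful only for \<open>b \<ge> 0\<close>. All vectors \<open>A\<^sub>j\<close> and
  all points of the parallelepiped are nonnegative under the theorem's hypotheses.
\<close>

definition zpow :: "nat \<Rightarrow> (nat \<Rightarrow> nat) \<Rightarrow> (nat \<Rightarrow> int) \<Rightarrow> int mfps" where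
  "zpow n \<pi> b = (\<Prod>i=1..n. mfps_var (\<pi> i) powi b i)"

definition descents :: "nat \<Rightarrow> (nat \<Rightarrow> nat) \<Rightarrow> nat set" where
  "descents n \<pi> = {j \<in> {1..n - 1}. \<pi> j > \<pi> (j + 1)}"

definition Lset :: "nat \<Rightarrow> (nat \<Rightarrow> int) \<Rightarrow> (nat \<Rightarrow> int) set" where
  "Lset n a = {l \<in> {1..n} \<rightarrow>\<^sub>E {0..}. \<forall>\<pi>. \<pi> permutes {1..n} \<longrightarrow> (\<Sum>j=1..n. a j * l (\<pi> j)) \<ge> 0}"

definition Avec :: "nat \<Rightarrow> (nat \<Rightarrow> int) \<Rightarrow> nat \<Rightarrow> nat \<Rightarrow> int" where
  "Avec n a j = (\<lambda>i\<in>{1..n}.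
     if j < n then (if i \<le> j then \<Sum>k=j+1..n. a k else - (\<Sum>k=1..j. a k)) else 1)"

definition parallelepiped :: "nat \<Rightarrow> (nat \<Rightarrow> int) \<Rightarrow> (nat \<Rightarrow> real) set" where
  "parallelepiped n a = {(\<lambda>i\<in>{1..n}. \<Sum>j=1..n. c j * of_int (Avec n a j i)) | c.
     \<forall>j\<in>{1..n}. 0 \<le> c j \<and> c j < 1}"

definition lattice_points :: "nat \<Rightarrow> (nat \<Rightarrow> real) set \<Rightarrow> (nat \<Rightarrow> int) set" where
  "lattice_points n P = {p \<in> {1..n} \<rightarrow>\<^sub>E UNIV. (\<lambda>i\<in>{1..n}. of_int (p i)) \<in> P}"

end

theory Submission
  imports Defs
begin

text \<open>
  The vectors \<open>A\<^sub>j\<close> span the cone of weakly decreasing \<open>x\<close> with \<open>\<Sum> a\<^sub>i x\<^sub>i \<ge> 0\<close>; since \<open>a\<close> is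
  increasing, every rearrangement of such an \<open>x\<close> also satisfies the inequality, and \<open>L\<close> is the set
  of all rearrangements of integral points of the cone. Each \<open>\<lambda> \<in> L\<close> is sorted by exactly one
  permutation \<open>\<pi>\<close> for which \<open>\<lambda> \<circ> \<pi>\<close> is weakly decreasing, and strictly so at the descents of
  \<open>\<pi>\<close>. Integral points of the cone are uniquely \<open>p + \<Sum> q\<^sub>j A\<^sub>j\<close> with \<open>p\<close> in the half-open
  parallelepiped and \<open>q\<^sub>j \<in> \<nat>\<close>, and strictness at a descent \<open>i\<close> with \<open>p\<^sub>i = p\<^sub>i\<^sub>+\<^sub>1\<close> means
  \<open>q\<^sub>i \<ge> 1\<close>, which is the extra factor in the numerator.
\<close>

section \<open>Generating functions of families of monomials\<close>

definition mfps_monom :: "(nat \<Rightarrow>\<^sub>0 nat) \<Rightarrow> 'a::comm_ring_1 mfps" where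
  "mfps_monom e = Abs_mfps (\<lambda>m. if m = e then 1 else 0)"

text \<open>The series summing the monomials with exponent \<open>\<phi> x\<close> over x in S,
  encoded by fibre counts so that identities of series become bijections. \<open>card\<close> is 0
  on an infinite fibre, hence the companion notion \<open>finite_fibres\<close>.\<close>

definition genf :: "('b \<Rightarrow> (nat \<Rightarrow>\<^sub>0 nat)) \<Rightarrow> 'b set \<Rightarrow> 'a::comm_ring_1 mfps" where
  "genf \<phi> S = Abs_mfps (\<lambda>e. of_nat (card {x \<in> S. \<phi> x = e}))"

definition finite_fibres :: "('b \<Rightarrow> 'c) \<Rightarrow> 'b set \<Rightarrow> bool" where
  "finite_fibres \<phi> S \<longleftrightarrow> (\<forall>e. finite {x \<in> S. \<phi> x = e})"

lemma mfps_nth_monom: "mfps_nth (mfps_monom e) m = (if m = e then 1 else 0)"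
  by (simp add: mfps_monom_def Abs_mfps_inverse)

lemma mfps_nth_genf: "mfps_nth (genf \<phi> S) e = of_nat (card {x \<in> S. \<phi> x = e})"
  by (simp add: genf_def Abs_mfps_inverse)

lemma genf_singleton: "genf \<phi> {x} = mfps_monom (\<phi> x)"
proof (rule mfps_eqI)
  fix m
  have "{y \<in> {x}. \<phi> y = m} = (if m = \<phi> x then {x} else {})"
    by auto
  then show "mfps_nth (genf \<phi> {x}) m = mfps_nth (mfps_monom (\<phi> x)) m"
    by (simp add: mfps_nth_genf mfps_nth_monom)
qed

lemma finite_fibres_finite: "finite S \<Longrightarrow> finite_fibres \<phi> S"
  by (simp add: finite_fibres_def)

lemma genf_bij_betw:
  assumes "bij_betw h S T" and "\<And>x. x \<in> S \<Longrightarrow> \<psi> (h x) = \<phi> x"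
  shows "genf \<phi> S = genf \<psi> T"
proof (rule mfps_eqI)
  fix e
  have "bij_betw h {x \<in> S. \<phi> x = e} {y \<in> T. \<psi> y = e}"
    using assms unfolding bij_betw_def by (auto intro: inj_on_subset)
  then show "mfps_nth (genf \<phi> S) e = mfps_nth (genf \<psi> T) e"
    by (simp add: mfps_nth_genf bij_betw_same_card)
qed

lemma finite_fibres_bij_betw:
  assumes "bij_betw h S T" and "\<And>x. x \<in> S \<Longrightarrow> \<psi> (h x) = \<phi> x" and "finite_fibres \<phi> S"
  shows "finite_fibres \<psi> T"
  unfolding finite_fibres_def
proof
  fix e
  have "{y \<in> T. \<psi> y = e} = h ` {x \<in> S. \<phi> x = e}"
    using assms(1,2) unfolding bij_betw_def by auto
  then show "finite {y \<in> T. \<psi> y = e}"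
    using assms(3) by (simp add: finite_fibres_def)
qed

lemma genf_Un_disjoint:
  assumes "finite_fibres \<phi> S" "finite_fibres \<phi> T" "S \<inter> T = {}"
  shows "genf \<phi> (S \<union> T) = genf \<phi> S + genf \<phi> T"
proof (rule mfps_eqI)
  fix e
  have "{x \<in> S \<union> T. \<phi> x = e} = {x \<in> S. \<phi> x = e} \<union> {x \<in> T. \<phi> x = e}"
    by auto
  moreover have "card \<dots> = card {x \<in> S. \<phi> x = e} + card {x \<in> T. \<phi> x = e}"
    using assms by (intro card_Un_disjoint) (auto simp: finite_fibres_def)
  ultimately show "mfps_nth (genf \<phi> (S \<union> T)) e = mfps_nth (genf \<phi> S + genf \<phi> T) e"
    by (simp add: mfps_nth_genf plus_mfps.rep_eq)
qed

lemma mfps_nth_sum: "mfps_nth (\<Sum>x\<in>S. f x) e = (\<Sum>x\<in>S. mfps_nth (f x) e)"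
  by (induction S rule: infinite_finite_induct) (simp_all add: zero_mfps.rep_eq plus_mfps.rep_eq)

lemma genf_Sigma:
  assumes "finite I" "\<And>i. i \<in> I \<Longrightarrow> finite_fibres (\<phi> i) (S i)"
  shows "genf (\<lambda>(i, x). \<phi> i x) (Sigma I S) = (\<Sum>i\<in>I. genf (\<phi> i) (S i))"
proof (rule mfps_eqI)
  fix e
  have "{z \<in> Sigma I S. (case z of (i, x) \<Rightarrow> \<phi> i x) = e} = (SIGMA i:I. {x \<in> S i. \<phi> i x = e})"
    by auto
  moreover have "card \<dots> = (\<Sum>i\<in>I. card {x \<in> S i. \<phi> i x = e})"
    using assms by (intro card_SigmaI) (auto simp: finite_fibres_def)
  ultimately show "mfps_nth (genf (\<lambda>(i, x). \<phi> i x) (Sigma I S)) e =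
      mfps_nth (\<Sum>i\<in>I. genf (\<phi> i) (S i)) e"
    by (simp add: mfps_nth_genf mfps_nth_sum)
qed

text \<open>The exponents of x and y form one of the finitely many splittings of e; this
  decomposition yields both finiteness of fibres and the Cauchy product.\<close>

lemma fibre_times:
  "{z \<in> S \<times> T. (case z of (x, y) \<Rightarrow> \<phi> x + \<psi> y) = e} =
    (\<Union>w\<in>expo_splits e. {x \<in> S. \<phi> x = fst w} \<times> {y \<in> T. \<psi> y = snd w})"
  by (auto simp: expo_splits_def)

lemma finite_fibres_times:
  fixes \<phi> :: "'b \<Rightarrow> (nat \<Rightarrow>\<^sub>0 nat)"
  assumes "finite_fibres \<phi> S" "finite_fibres \<psi> T"
  shows "finite_fibres (\<lambda>(x, y). \<phi> x + \<psi> y) (S \<times> T)"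
  using assms unfolding finite_fibres_def fibre_times by auto

lemma genf_times:
  assumes "finite_fibres \<phi> S" "finite_fibres \<psi> T"
  shows "genf \<phi> S * genf \<psi> T = genf (\<lambda>(x, y). \<phi> x + \<psi> y) (S \<times> T)"
proof (rule mfps_eqI)
  fix e
  have "card {z \<in> S \<times> T. (case z of (x, y) \<Rightarrow> \<phi> x + \<psi> y) = e} =
      (\<Sum>w\<in>expo_splits e. card ({x \<in> S. \<phi> x = fst w} \<times> {y \<in> T. \<psi> y = snd w}))"
    unfolding fibre_times
    using assms by (intro card_UN_disjoint) (auto simp: finite_fibres_def)
  then show "mfps_nth (genf \<phi> S * genf \<psi> T) e =
      mfps_nth (genf (\<lambda>(x, y). \<phi> x + \<psi> y) (S \<times> T)) e"
    by (simp add: mfps_nth_genf times_mfps.rep_eq case_prod_beta card_cartesian_product)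
qed

lemma monom_times_genf:
  assumes "finite_fibres \<phi> S"
  shows "mfps_monom u * genf \<phi> S = genf (\<lambda>x. u + \<phi> x) S"
proof -
  have "mfps_monom u * genf \<phi> S = genf (\<lambda>_. u) {()} * genf \<phi> S"
    by (simp add: genf_singleton)
  also have "\<dots> = genf (\<lambda>(_, x). u + \<phi> x) ({()} \<times> S)"
    by (rule genf_times) (simp_all add: assms finite_fibres_finite)
  also have "\<dots> = genf (\<lambda>x. u + \<phi> x) S"
    by (rule genf_bij_betw [where h = snd]) (auto simp: bij_betw_def inj_on_def image_iff)
  finally show ?thesis .
qed

lemma finite_fibres_shift:
  fixes u :: "nat \<Rightarrow>\<^sub>0 nat"
  assumes "finite_fibres \<phi> S"
  shows "finite_fibres (\<lambda>x. u + \<phi> x) S"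
  unfolding finite_fibres_def
proof
  fix e
  \<comment> \<open>Subtraction of exponents is truncated, but it cancels u, and an inclusion
    suffices.\<close>
  have "{x \<in> S. u + \<phi> x = e} \<subseteq> {x \<in> S. \<phi> x = e - u}"
    by auto
  then show "finite {x \<in> S. u + \<phi> x = e}"
    using assms finite_subset unfolding finite_fibres_def by blast
qed

section \<open>Monomial arithmetic and geometric series\<close>

lemma monom_mult: "mfps_monom u * mfps_monom v = mfps_monom (u + v)"
  using monom_times_genf [of "\<lambda>_. v" "{()}" u]
  by (simp add: genf_singleton finite_fibres_finite)

lemma monom_zero: "mfps_monom 0 = 1"
  by (rule mfps_eqI) (simp add: mfps_nth_monom one_mfps.rep_eq)

lemma monom_prod: "(\<Prod>i\<in>S. mfps_monom (u i)) = mfps_monom (\<Sum>i\<in>S. u i)"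
  by (induction S rule: infinite_finite_induct) (simp_all add: monom_zero monom_mult)

lemma monom_power: "mfps_monom u ^ k = mfps_monom (of_nat k * u)"
  by (induction k) (simp_all add: monom_zero monom_mult algebra_simps)

lemma lookup_of_nat_times:
  fixes u :: "nat \<Rightarrow>\<^sub>0 nat"
  shows "Poly_Mapping.lookup (of_nat k * u) x = k * Poly_Mapping.lookup u x"
  by (induction k) (simp_all add: algebra_simps lookup_add)

lemma finite_fibres_multiples:
  fixes u :: "nat \<Rightarrow>\<^sub>0 nat"
  assumes "u \<noteq> 0"
  shows "finite_fibres (\<lambda>k. of_nat k * u) UNIV"
  unfolding finite_fibres_def
proof
  fix e
  \<comment> \<open>A coordinate where u is positive bounds k, because k copies of u contribute at
    least k there.\<close>
  from assms obtain x where x: "Poly_Mapping.lookup u x > 0"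
    by (metis gr0I lookup_zero poly_mapping_eqI)
  have "k \<le> Poly_Mapping.lookup e x" if "of_nat k * u = e" for k
    using x unfolding that [symmetric] lookup_of_nat_times by simp
  then have "{k \<in> UNIV. of_nat k * u = e} \<subseteq> {..Poly_Mapping.lookup e x}"
    by auto
  then show "finite {k \<in> UNIV. of_nat k * u = e}"
    by (rule finite_subset) simp
qed

lemma UNIV_nat_split: "(UNIV :: nat set) = {0} \<union> range Suc"
  using not0_implies_Suc by auto

text \<open>Separating k = 0 from the successors gives G = 1 + z^u G for the series G of all
  multiples of u; u being nonzero keeps the fibres finite.\<close>

lemma geometric_monom:
  assumes "u \<noteq> 0"
  shows "(1 - mfps_monom u) * genf (\<lambda>k. of_nat k * u) UNIV = 1"
proof -
  note fin = finite_fibres_multiples [OF assms]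
  have fin': "finite_fibres (\<lambda>k. of_nat k * u) A" for A
    using fin unfolding finite_fibres_def
    by (metis (mono_tags, lifting) Collect_mono UNIV_I finite_subset)
  have "genf (\<lambda>k. of_nat k * u) UNIV = genf (\<lambda>k. of_nat k * u) ({0} \<union> range Suc)"
    using UNIV_nat_split by simp
  also have "\<dots> = genf (\<lambda>k. of_nat k * u) {0} + genf (\<lambda>k. of_nat k * u) (range Suc)"
    by (rule genf_Un_disjoint) (auto intro: fin')
  also have "genf (\<lambda>k. of_nat k * u) {0} = 1"
    by (simp add: genf_singleton monom_zero)
  also have "genf (\<lambda>k. of_nat k * u) (range Suc) = genf (\<lambda>k. u + of_nat k * u) UNIV"
    by (rule genf_bij_betw [where h = Suc, symmetric]) (auto simp: bij_betw_def algebra_simps)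
  also have "\<dots> = mfps_monom u * genf (\<lambda>k. of_nat k * u) UNIV"
    by (rule monom_times_genf [OF fin, symmetric])
  finally have "genf (\<lambda>k. of_nat k * u) UNIV - mfps_monom u * genf (\<lambda>k. of_nat k * u) UNIV = 1"
    by (metis add_diff_cancel_right')
  then show ?thesis
    by (simp add: left_diff_distrib)
qed

text \<open>Induction on J, with the multiplicity at the new index as an independent factor. The two
  claims go together because \<open>genf_times\<close> needs finite fibres for the family over
  J.\<close>

lemma prod_geometric_monom:
  assumes "finite J" "\<And>j. j \<in> J \<Longrightarrow> u j \<noteq> 0"
  shows "finite_fibres (\<lambda>m. \<Sum>j\<in>J. of_nat (m j) * u j) (J \<rightarrow>\<^sub>E UNIV) \<and>
    (\<Prod>j\<in>J. 1 - mfps_monom (u j)) * genf (\<lambda>m. \<Sum>j\<in>J. of_nat (m j) * u j) (J \<rightarrow>\<^sub>E UNIV) =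
      (1 :: 'a::comm_ring_1 mfps)"
  using assms
proof (induction J rule: finite_induct)
  case empty
  then show ?case
    by (simp add: genf_singleton monom_zero finite_fibres_finite)
next
  case (insert j J)
  let ?\<phi> = "\<lambda>J m. \<Sum>j\<in>J. of_nat (m j) * u j"
  let ?h = "\<lambda>(k, m). m(j := k)"
  from insert have IH: "finite_fibres (?\<phi> J) (J \<rightarrow>\<^sub>E UNIV)"
    "(\<Prod>j\<in>J. 1 - mfps_monom (u j)) * genf (?\<phi> J) (J \<rightarrow>\<^sub>E UNIV) = (1 :: 'a mfps)" and "u j \<noteq> 0"
    by auto
  have bij: "bij_betw ?h (UNIV \<times> (J \<rightarrow>\<^sub>E UNIV)) (insert j J \<rightarrow>\<^sub>E UNIV)"
    using inj_combinator [OF \<open>j \<notin> J\<close>, of "\<lambda>_. UNIV"]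
    by (simp add: bij_betw_def PiE_insert_eq)
  have val: "?\<phi> (insert j J) (?h z) = (case z of (k, m) \<Rightarrow> of_nat k * u j + ?\<phi> J m)" for z
  proof (cases z)
    case (Pair k m)
    have "?\<phi> J (m(j := k)) = ?\<phi> J m"
      using insert.hyps by (intro sum.cong) auto
    then show ?thesis
      using insert.hyps Pair by simp
  qed
  note fin = finite_fibres_multiples [OF \<open>u j \<noteq> 0\<close>]
  have genf: "genf (?\<phi> (insert j J)) (insert j J \<rightarrow>\<^sub>E UNIV) =
      (genf (\<lambda>k. of_nat k * u j) UNIV * genf (?\<phi> J) (J \<rightarrow>\<^sub>E UNIV) :: 'a mfps)"
    unfolding genf_times [OF fin IH(1)] using bij val by (intro genf_bij_betw [symmetric])
  have "(\<Prod>j\<in>insert j J. 1 - mfps_monom (u j)) *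
        genf (?\<phi> (insert j J)) (insert j J \<rightarrow>\<^sub>E UNIV) =
      ((1 - mfps_monom (u j)) * genf (\<lambda>k. of_nat k * u j) UNIV) *
      ((\<Prod>j\<in>J. 1 - mfps_monom (u j)) * genf (?\<phi> J) (J \<rightarrow>\<^sub>E UNIV) :: 'a mfps)"
    unfolding genf prod.insert [OF insert.hyps] by (simp only: mult_ac)
  also have "\<dots> = (1 :: 'a mfps)"
    by (simp add: IH(2) geometric_monom [OF \<open>u j \<noteq> 0\<close>])
  finally have "(\<Prod>j\<in>insert j J. 1 - mfps_monom (u j)) *
      genf (?\<phi> (insert j J)) (insert j J \<rightarrow>\<^sub>E UNIV) = (1 :: 'a mfps)" .
  moreover have "finite_fibres (?\<phi> (insert j J)) (insert j J \<rightarrow>\<^sub>E UNIV)"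
    by (rule finite_fibres_bij_betw [OF bij _ finite_fibres_times [OF fin IH(1)]]) (rule val)
  ultimately show ?case
    by blast
qed


section \<open>Exponent vectors\<close>

text \<open>\<open>nat\<close> sends negative coordinates to 0, so this is the exponent of z_\<pi>^b
  for nonnegative b, as in \<open>zpow_eq_monom\<close>.\<close>

definition expo :: "nat \<Rightarrow> (nat \<Rightarrow> nat) \<Rightarrow> (nat \<Rightarrow> int) \<Rightarrow> (nat \<Rightarrow>\<^sub>0 nat)" where
  "expo n \<pi> b = (\<Sum>i=1..n. Poly_Mapping.single (\<pi> i) (nat (b i)))"

lemma of_nat_times_single:
  "of_nat k * Poly_Mapping.single i (l :: nat) = Poly_Mapping.single (i :: nat) (k * l)"
  by (rule poly_mapping_eqI) (simp add: lookup_of_nat_times lookup_single when_def)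

lemma zpow_eq_monom:
  assumes "\<And>i. i \<in> {1..n} \<Longrightarrow> 0 \<le> b i"
  shows "zpow n \<pi> b = mfps_monom (expo n \<pi> b)"
proof -
  have var: "mfps_var i = mfps_monom (Poly_Mapping.single i 1)" for i
    by (simp add: mfps_var_def mfps_monom_def)
  have "zpow n \<pi> b = (\<Prod>i=1..n. mfps_monom (Poly_Mapping.single (\<pi> i) (nat (b i))))"
    unfolding zpow_def
  proof (rule prod.cong)
    fix i assume "i \<in> {1..n}"
    then show "mfps_var (\<pi> i) powi b i = mfps_monom (Poly_Mapping.single (\<pi> i) (nat (b i)))"
      using assms [of i] by (simp add: power_int_def var monom_power of_nat_times_single)
  qed simp
  then show ?thesis
    by (simp add: monom_prod expo_def)
qed

lemma expo_cong: "(\<And>i. i \<in> {1..n} \<Longrightarrow> b i = c i) \<Longrightarrow> expo n \<pi> b = expo n \<pi> c"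
  unfolding expo_def by (rule sum.cong) auto

lemma expo_add:
  assumes "\<And>i. i \<in> {1..n} \<Longrightarrow> 0 \<le> b i" "\<And>i. i \<in> {1..n} \<Longrightarrow> 0 \<le> c i"
  shows "expo n \<pi> (\<lambda>i. b i + c i) = expo n \<pi> b + expo n \<pi> c"
  unfolding expo_def sum.distrib [symmetric]
  using assms by (intro sum.cong) (auto simp: nat_add_distrib single_add)

lemma expo_scale: "expo n \<pi> (\<lambda>i. int k * b i) = of_nat k * expo n \<pi> b"
  by (simp add: expo_def sum_distrib_left of_nat_times_single nat_mult_distrib)

lemma expo_sum:
  assumes "\<And>i j. i \<in> {1..n} \<Longrightarrow> j \<in> J \<Longrightarrow> 0 \<le> b j i"
  shows "expo n \<pi> (\<lambda>i. \<Sum>j\<in>J. b j i) = (\<Sum>j\<in>J. expo n \<pi> (b j))"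
  using assms
proof (induction J rule: infinite_finite_induct)
  case (insert j J)
  have "expo n \<pi> (\<lambda>i. b j i + (\<Sum>j\<in>J. b j i)) = expo n \<pi> (b j) + expo n \<pi> (\<lambda>i. \<Sum>j\<in>J. b j i)"
    using insert.prems by (intro expo_add sum_nonneg) auto
  then show ?case
    using insert by simp
qed (simp_all add: expo_def)

lemma expo_nonzero:
  assumes "i \<in> {1..n}" "0 < b i"
  shows "expo n \<pi> b \<noteq> 0"
proof -
  \<comment> \<open>Only a lower bound, since for arbitrary \<open>\<pi>\<close> other indices k may
    satisfy \<open>\<pi> k = \<pi> i\<close>.\<close>
  have "nat (b i) \<le> (\<Sum>k=1..n. Poly_Mapping.lookup (Poly_Mapping.single (\<pi> k) (nat (b k))) (\<pi> i))"
    using assms(1) member_le_sum [of i "{1..n}"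
      "\<lambda>k. Poly_Mapping.lookup (Poly_Mapping.single (\<pi> k) (nat (b k))) (\<pi> i)"] by simp
  then have "Poly_Mapping.lookup (expo n \<pi> b) (\<pi> i) > 0"
    using assms(2) by (simp add: expo_def lookup_sum)
  then show ?thesis
    by auto
qed

text \<open>Reindexing of the sum; it trades a vector in the variables z for its rearrangement in
  the variables z_\<pi>.\<close>

lemma expo_permute:
  assumes "\<pi> permutes {1..n}"
  shows "expo n id l = expo n \<pi> (\<lambda>i. l (\<pi> i))"
  unfolding expo_def using sum.permute [OF assms, of "\<lambda>i. Poly_Mapping.single i (nat (l i))"]
  by (simp add: comp_def)

text \<open>Each member contributes 0 or 1 to a given coefficient, so the formal sum counts a
  fibre.\<close>

lemma mfps_sum_zpow:
  assumes "\<And>l i. l \<in> S \<Longrightarrow> i \<in> {1..n} \<Longrightarrow> 0 \<le> l i"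
  shows "mfps_sum (zpow n \<pi>) S = genf (expo n \<pi>) S"
proof (rule mfps_eqI)
  fix e
  have nth: "mfps_nth (zpow n \<pi> l) e = (if expo n \<pi> l = e then 1 else 0)" if "l \<in> S" for l
    using zpow_eq_monom [of n l \<pi>] assms [OF that] by (simp add: mfps_nth_monom)
  have "mfps_nth (mfps_sum (zpow n \<pi>) S) e =
      (\<Sum>l | l \<in> S \<and> mfps_nth (zpow n \<pi> l) e \<noteq> 0. mfps_nth (zpow n \<pi> l) e)"
    by (simp add: mfps_sum_def Abs_mfps_inverse)
  also have "\<dots> = (\<Sum>l | l \<in> S \<and> expo n \<pi> l = e. 1)"
    using nth by (intro sum.cong) (auto split: if_splits)
  finally show "mfps_nth (mfps_sum (zpow n \<pi>) S) e = mfps_nth (genf (expo n \<pi>) S) e"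
    by (simp add: mfps_nth_genf)
qed


section \<open>Sorting permutations\<close>

text \<open>Existence: list the K-values increasingly and pull them back through K. Uniqueness: a
  strictly increasing list is determined by its set of entries.\<close>

lemma ex1_sorting_permutation:
  fixes K :: "nat \<Rightarrow> int"
  assumes inj: "inj_on K {1..n}"
  shows "\<exists>!\<pi>. \<pi> permutes {1..n} \<and> (\<forall>i\<in>{1..n-1}. K (\<pi> i) < K (\<pi> (i + 1)))"
proof (rule ex_ex1I)
  define xs where "xs = sorted_list_of_set (K ` {1..n})"
  have len: "length xs = n"
    using inj by (simp add: xs_def card_image)
  have set: "set xs = K ` {1..n}"
    by (simp add: xs_def)
  \<comment> \<open>Lists are indexed from 0 and positions from 1, hence the shift; the value i
    outside \<open>{1..n}\<close> is what \<open>permutes\<close> demands.\<close>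
  define f where "f i = (if i \<in> {1..n} then inv_into {1..n} K (xs ! (i - 1)) else i)" for i
  have "bij_betw (\<lambda>i. i - 1) {1..n} {..<n}"
    by (rule bij_betw_byWitness [where f' = Suc]) auto
  moreover have "distinct xs"
    by (simp add: xs_def)
  then have "bij_betw ((!) xs) {..<n} (K ` {1..n})"
    by (rule bij_betw_nth) (simp_all add: len set)
  moreover have "bij_betw (inv_into {1..n} K) (K ` {1..n}) {1..n}"
    using inj by (intro bij_betw_inv_into) (simp add: bij_betw_def)
  ultimately have "bij_betw (inv_into {1..n} K \<circ> (!) xs \<circ> (\<lambda>i. i - 1)) {1..n} {1..n}"
    by (blast intro: bij_betw_trans)
  then have "bij_betw f {1..n} {1..n}"
    by (rule bij_betw_cong [THEN iffD1, rotated]) (simp add: f_def)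
  then have "f permutes {1..n}"
    by (rule bij_imp_permutes) (auto simp: f_def)
  moreover have "K (f i) = xs ! (i - 1)" if "i \<in> {1..n}" for i
  proof -
    have "xs ! (i - 1) \<in> K ` {1..n}"
      using that len set nth_mem [of "i - 1" xs] by auto
    then show ?thesis
      using that by (simp add: f_def f_inv_into_f)
  qed
  then have "K (f i) < K (f (i + 1))" if "i \<in> {1..n-1}" for i
    using that sorted_wrt_nth_less [of "(<)" xs "i - 1" i] len by (auto simp: xs_def)
  ultimately show "\<exists>\<pi>. \<pi> permutes {1..n} \<and> (\<forall>i\<in>{1..n-1}. K (\<pi> i) < K (\<pi> (i + 1)))"
    by blast
next
  define ys where "ys \<pi> = map (\<lambda>i. K (\<pi> (i + 1))) [0..<n]" for \<pi> :: "nat \<Rightarrow> nat"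
  have ys: "sorted_wrt (<) (ys \<pi>) \<and> set (ys \<pi>) = K ` {1..n}"
    if "\<pi> permutes {1..n} \<and> (\<forall>i\<in>{1..n-1}. K (\<pi> i) < K (\<pi> (i + 1)))" for \<pi>
  proof
    show "sorted_wrt (<) (ys \<pi>)"
      using that by (subst sorted_wrt_iff_nth_Suc_transp) (auto simp: ys_def)
    have "set (ys \<pi>) = K ` \<pi> ` Suc ` {0..<n}"
      by (simp add: ys_def image_image del: image_Suc_atLeastLessThan)
    also have "Suc ` {0..<n} = {1..n}"
      by (simp add: atLeastLessThanSuc_atLeastAtMost)
    finally show "set (ys \<pi>) = K ` {1..n}"
      using that by (simp add: permutes_image)
  qed
  fix \<pi> \<sigma>
  assume \<pi>: "\<pi> permutes {1..n} \<and> (\<forall>i\<in>{1..n-1}. K (\<pi> i) < K (\<pi> (i + 1)))"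
    and \<sigma>: "\<sigma> permutes {1..n} \<and> (\<forall>i\<in>{1..n-1}. K (\<sigma> i) < K (\<sigma> (i + 1)))"
  have "ys \<pi> = ys \<sigma>"
    using ys [OF \<pi>] ys [OF \<sigma>] by (intro strict_sorted_equal) auto
  show "\<pi> = \<sigma>"
  proof
    fix i
    show "\<pi> i = \<sigma> i"
    proof (cases "i \<in> {1..n}")
      case True
      then have "ys \<pi> ! (i - 1) = ys \<sigma> ! (i - 1)" "i - 1 < n"
        using \<open>ys \<pi> = ys \<sigma>\<close> by auto
      then have "K (\<pi> i) = K (\<sigma> i)"
        using True by (simp add: ys_def)
      moreover have "\<pi> i \<in> {1..n}" "\<sigma> i \<in> {1..n}"
        using True permutes_in_image [of \<pi> "{1..n}" i] permutes_in_image [of \<sigma> "{1..n}" i] \<pi> \<sigma>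
        by simp_all
      ultimately show ?thesis
        by (rule inj_onD [OF inj])
    next
      case False
      then show ?thesis
        using \<pi> \<sigma> by (metis permutes_not_in)
    qed
  qed
qed

text \<open>Strictness at descents means that equal entries are listed by increasing index: this is
  the stable decreasing sort, which selects one permutation even when l has ties.\<close>

definition sorts :: "nat \<Rightarrow> (nat \<Rightarrow> nat) \<Rightarrow> (nat \<Rightarrow> int) \<Rightarrow> bool" where
  "sorts n \<pi> l \<longleftrightarrow> \<pi> permutes {1..n} \<and>
    (\<forall>i\<in>{1..n-1}. l (\<pi> (i + 1)) \<le> l (\<pi> i) \<and> (i \<in> descents n \<pi> \<longrightarrow> l (\<pi> (i + 1)) < l (\<pi> i)))"

lemma ex1_sorts: "\<exists>!\<pi>. sorts n \<pi> l"
proof -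
  \<comment> \<open>Ordering by \<open>K\<close> is ordering by decreasing \<open>l\<close>, ties being broken by increasing index.\<close>
  define K where "K i = int i - int (n + 1) * l i" for i
  \<comment> \<open>A gap of at least 1 in l moves K by at least n + 1, and the index i, at most n,
    cannot make up for it.\<close>
  have gt: "K i < K k" if "i \<in> {1..n}" "l k < l i" for i k
  proof -
    have "int (n + 1) * (l k + 1) \<le> int (n + 1) * l i"
      using that by (intro mult_left_mono) auto
    then show ?thesis
      using that by (simp add: K_def algebra_simps)
  qed
  have less_iff: "K i < K k \<longleftrightarrow> l k < l i \<or> l i = l k \<and> i < k" if "i \<in> {1..n}" "k \<in> {1..n}" for i k
    using gt [of i k] gt [of k i] that by (cases "l i" "l k" rule: linorder_cases) (auto simp: K_def)
  have inj: "inj_on K {1..n}"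
  proof (rule inj_onI)
    fix i k assume "i \<in> {1..n}" "k \<in> {1..n}" "K i = K k"
    then show "i = k"
      using less_iff [of i k] less_iff [of k i] by (metis less_irrefl linorder_neqE)
  qed
  have "sorts n \<pi> l \<longleftrightarrow> \<pi> permutes {1..n} \<and> (\<forall>i\<in>{1..n-1}. K (\<pi> i) < K (\<pi> (i + 1)))" for \<pi>
  proof (cases "\<pi> permutes {1..n}")
    case True
    have "l (\<pi> (i + 1)) \<le> l (\<pi> i) \<and> (i \<in> descents n \<pi> \<longrightarrow> l (\<pi> (i + 1)) < l (\<pi> i)) \<longleftrightarrow>
        K (\<pi> i) < K (\<pi> (i + 1))" if i: "i \<in> {1..n-1}" for i
    proof -
      have "\<pi> i \<in> {1..n}" "\<pi> (i + 1) \<in> {1..n}"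
        using i permutes_in_image [OF True, of i] permutes_in_image [OF True, of "i + 1"] by auto
      \<comment> \<open>The two values differ, so a non-descent is a strict ascent, which is the
        tie-breaking clause of \<open>less_iff\<close>.\<close>
      moreover have "\<pi> i \<noteq> \<pi> (i + 1)"
        using permutes_inj [OF True] by (simp add: inj_eq)
      ultimately show ?thesis
        using i by (subst less_iff) (auto simp: descents_def)
    qed
    then show ?thesis
      using True by (simp add: sorts_def)
  qed (simp add: sorts_def)
  then show ?thesis
    using ex1_sorting_permutation [OF inj] by simp
qed


section \<open>Coordinates with respect to the cone generators\<close>

text \<open>Up to the factor \<open>a\<^sub>1 + \<dots> + a\<^sub>n\<close>, these are the dual basis of \<open>A\<^sub>1, \<dots>, A\<^sub>n\<close>.\<close>

definition coord :: "nat \<Rightarrow> (nat \<Rightarrow> int) \<Rightarrow> nat \<Rightarrow> (nat \<Rightarrow> 'a::comm_ring_1) \<Rightarrow> 'a" where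
  "coord n a j x = (if j < n then x j - x (j + 1) else \<Sum>i=1..n. of_int (a i) * x i)"

lemma coord_cong:
  assumes "j \<in> {1..n}" "\<And>i. i \<in> {1..n} \<Longrightarrow> x i = y i"
  shows "coord n a j x = coord n a j y"
  using assms unfolding coord_def by (auto intro!: sum.cong)

lemma coord_add: "coord n a j (\<lambda>i. x i + y i) = coord n a j x + coord n a j y"
  by (simp add: coord_def algebra_simps sum.distrib)

lemma coord_diff: "coord n a j (\<lambda>i. x i - y i) = coord n a j x - coord n a j y"
  by (simp add: coord_def algebra_simps sum_subtractf)

lemma coord_scale: "coord n a j (\<lambda>i. c * x i) = c * coord n a j x"
  by (simp add: coord_def algebra_simps sum_distrib_left)

lemma coord_zero: "coord n a j (\<lambda>i. 0) = 0"
  by (simp add: coord_def)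

lemma coord_sum: "coord n a j (\<lambda>i. \<Sum>k\<in>S. c k * x k i) = (\<Sum>k\<in>S. c k * coord n a j (x k))"
  by (induction S rule: infinite_finite_induct) (simp_all add: coord_zero coord_add coord_scale)

text \<open>Lets integral points and real combinations in the parallelepiped share one set of
  coordinates.\<close>

lemma coord_of_int: "coord n a j (\<lambda>i. of_int (x i)) = of_int (coord n a j x)"
  by (simp add: coord_def)

section \<open>Duality between coordinates and cone generators\<close>

locale cone_weights =
  fixes n :: nat and a :: "nat \<Rightarrow> int"
  assumes n_pos: "n \<ge> 1"
    and a_mono: "\<And>i j. 1 \<le> i \<Longrightarrow> i \<le> j \<Longrightarrow> j \<le> n \<Longrightarrow> a i \<le> a j"
    and partial_sum_nonpos: "\<And>j. 1 \<le> j \<Longrightarrow> j \<le> n - 1 \<Longrightarrow> (\<Sum>i=1..j. a i) \<le> 0"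
    and total_pos: "(\<Sum>i=1..n. a i) \<ge> 1"
begin

abbreviation s :: int where "s \<equiv> \<Sum>i=1..n. a i"

lemma total_split:
  assumes "j \<le> n"
  shows "s = (\<Sum>i=1..j. a i) + (\<Sum>i=j+1..n. a i)"
  using sum.ub_add_nat [of 1 j a "n - j"] assms by simp

text \<open>For j < n, the tail sum past j is s minus a nonpositive partial sum, hence at least 1;
  the other entries are negated partial sums.\<close>

lemma Avec_nonneg:
  assumes "i \<in> {1..n}" "j \<in> {1..n}"
  shows "0 \<le> Avec n a j i"
proof (cases "j < n")
  case True
  then have "j \<le> n - 1"
    by simp
  then show ?thesis
    using True assms total_split [of j] partial_sum_nonpos [of j] total_pos
    by (simp add: Avec_def)
qed (use assms in \<open>simp add: Avec_def\<close>)

text \<open>Makes the exponent of every generator nonzero, as the geometric series requires.\<close>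

lemma Avec_first_pos:
  assumes "j \<in> {1..n}"
  shows "0 < Avec n a j 1"
proof (cases "j < n")
  case True
  then have "j \<le> n - 1"
    by simp
  then show ?thesis
    using True assms n_pos total_split [of j] partial_sum_nonpos [of j] total_pos
    by (simp add: Avec_def)
qed (use assms n_pos in \<open>simp add: Avec_def\<close>)

text \<open>With T the sum of a past j, P the sum up to j and b the sum over positions i with
  \<open>\<tau> i \<le> j\<close>, the value is b T - (s - b) P, and T + P = s. The identity
  permutation serves duality, general \<tau> the rearrangements.\<close>

lemma weighted_sum_Avec:
  assumes j: "j \<in> {1..<n}" and \<tau>: "\<tau> permutes {1..n}"
  shows "(\<Sum>i=1..n. a i * Avec n a j (\<tau> i)) = s * ((\<Sum>i | i \<in> {1..n} \<and> \<tau> i \<le> j. a i) - (\<Sum>i=1..j. a i))"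
proof -
  let ?B = "{i. i \<in> {1..n} \<and> \<tau> i \<le> j}"
  let ?T = "\<Sum>k=j+1..n. a k" and ?P = "\<Sum>k=1..j. a k"
  have "(\<Sum>i=1..n. a i * Avec n a j (\<tau> i)) = (\<Sum>i=1..n. if \<tau> i \<le> j then a i * ?T else a i * - ?P)"
  proof (rule sum.cong)
    fix i assume "i \<in> {1..n}"
    then have "\<tau> i \<in> {1..n}"
      using permutes_in_image [OF \<tau>] by simp
    then show "a i * Avec n a j (\<tau> i) = (if \<tau> i \<le> j then a i * ?T else a i * - ?P)"
      using j by (simp add: Avec_def)
  qed simp
  also have "\<dots> = (\<Sum>i\<in>?B. a i * ?T) + (\<Sum>i\<in>{1..n} - ?B. a i * - ?P)"
    by (subst sum.If_cases) (auto intro!: arg_cong2 [where f = "(+)"] sum.cong)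
  also have "\<dots> = (\<Sum>i\<in>?B. a i) * ?T - (s - (\<Sum>i\<in>?B. a i)) * ?P"
    by (subst sum_diff [of _ ?B a, symmetric]) (auto simp: sum_distrib_right sum_negf)
  also have "\<dots> = s * ((\<Sum>i\<in>?B. a i) - ?P)"
    using total_split [of j] j by (simp add: algebra_simps)
  finally show ?thesis .
qed

text \<open>For j < n the entries of A_j drop only after position j, by s; the weighted sum vanishes
  on A_j by \<open>weighted_sum_Avec\<close> at the identity. On the all-ones vector the drops
  vanish and the weighted sum is s.\<close>

lemma coord_Avec:
  assumes "k \<in> {1..n}" "j \<in> {1..n}"
  shows "coord n a k (Avec n a j) = (if j = k then s else 0)"
proof (cases "k < n")
  case True
  then show ?thesis
    using assms total_split [of j] by (auto simp: coord_def Avec_def)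
next
  case False
  then have k: "k = n"
    using assms by simp
  show ?thesis
  proof (cases "j < n")
    case True
    then have "{i. i \<in> {1..n} \<and> id i \<le> j} = {1..j}"
      by auto
    then show ?thesis
      using weighted_sum_Avec [of j id] assms k True by (simp add: coord_def permutes_id)
  qed (use assms k in \<open>simp add: coord_def Avec_def\<close>)
qed

lemma coord_Avec_comb:
  assumes "k \<in> {1..n}"
  shows "coord n a k (\<lambda>i. \<Sum>j=1..n. c j * of_int (Avec n a j i)) = c k * of_int s"
proof -
  have "coord n a k (\<lambda>i. \<Sum>j=1..n. c j * of_int (Avec n a j i)) =
      (\<Sum>j=1..n. c j * of_int (coord n a k (Avec n a j)))"
    by (simp only: coord_sum coord_of_int)
  also have "\<dots> = (\<Sum>j=1..n. if j = k then c k * of_int s else 0)"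
    using assms by (intro sum.cong) (auto simp: coord_Avec simp del: of_int_sum)
  also have "\<dots> = c k * of_int s"
    using assms by (subst sum.delta) auto
  finally show ?thesis .
qed

text \<open>Vanishing drops make x constant on \<open>{1..n}\<close>, and the last coordinate is
  then \<open>s * x 1\<close> with s positive.\<close>

lemma coord_eq_0_imp:
  fixes x :: "nat \<Rightarrow> int"
  assumes zero: "\<And>k. k \<in> {1..n} \<Longrightarrow> coord n a k x = 0" and i: "i \<in> {1..n}"
  shows "x i = 0"
proof -
  have const: "x i = x 1" if "1 \<le> i" "i \<le> n" for i
    using that
  proof (induction i rule: dec_induct)
    case (step m)
    then show ?case
      using zero [of m] by (simp add: coord_def)
  qed simp
  have "coord n a n x = (\<Sum>i=1..n. a i * x i)"
    by (simp add: coord_def)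
  also have "\<dots> = (\<Sum>i=1..n. a i * x 1)"
  proof (rule sum.cong)
    fix i assume "i \<in> {1..n}"
    then have "x i = x 1"
      by (intro const) auto
    then show "a i * x i = a i * x 1"
      by simp
  qed simp
  also have "\<dots> = s * x 1"
    by (simp add: sum_distrib_right)
  finally have "x 1 = 0"
    using zero [of n] n_pos total_pos by auto
  then show ?thesis
    using const [of i] i by simp
qed

text \<open>By duality both sides have the same coordinates, so their difference vanishes. The
  factor s keeps the identity integral.\<close>

lemma coord_expansion:
  fixes x :: "nat \<Rightarrow> int"
  assumes "i \<in> {1..n}"
  shows "s * x i = (\<Sum>j=1..n. coord n a j x * Avec n a j i)"
proof -
  have "s * x i - (\<Sum>j=1..n. coord n a j x * Avec n a j i) = 0"
  proof (rule coord_eq_0_imp [where i = i])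
    fix k assume "k \<in> {1..n}"
    then show "coord n a k (\<lambda>i. s * x i - (\<Sum>j=1..n. coord n a j x * Avec n a j i)) = 0"
      using coord_Avec_comb [of k "\<lambda>j. coord n a j x"] by (simp add: coord_diff coord_scale)
  qed (fact assms)
  then show ?thesis
    by simp
qed

lemma nonneg_if_coords_nonneg:
  fixes x :: "nat \<Rightarrow> int"
  assumes "\<And>j. j \<in> {1..n} \<Longrightarrow> 0 \<le> coord n a j x" "i \<in> {1..n}"
  shows "0 \<le> x i"
proof -
  have "0 \<le> s * x i"
    unfolding coord_expansion [OF assms(2)]
    using assms by (intro sum_nonneg mult_nonneg_nonneg Avec_nonneg) auto
  then show ?thesis
    using total_pos by (simp add: zero_le_mult_iff)
qed

text \<open>The coefficient of A_j in p is its j-th coordinate divided by s, so the half-open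
  condition says that the coordinates are residues modulo s.\<close>

lemma lattice_points_iff:
  "p \<in> lattice_points n (parallelepiped n a) \<longleftrightarrow>
    p \<in> extensional {1..n} \<and> (\<forall>j\<in>{1..n}. 0 \<le> coord n a j p \<and> coord n a j p < s)"
proof safe
  assume p: "p \<in> lattice_points n (parallelepiped n a)"
  then show "p \<in> extensional {1..n}"
    by (simp add: lattice_points_def PiE_def)
  from p obtain c where
    eq: "(\<lambda>i\<in>{1..n}. real_of_int (p i)) = (\<lambda>i\<in>{1..n}. \<Sum>j=1..n. c j * real_of_int (Avec n a j i))"
    and c: "\<forall>j\<in>{1..n}. 0 \<le> c j \<and> c j < 1"
    by (auto simp: lattice_points_def parallelepiped_def)
  fix j assume j: "j \<in> {1..n}"
  have "real_of_int (coord n a j p) = coord n a j (\<lambda>i. real_of_int (p i))"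
    by (simp add: coord_of_int)
  also have "\<dots> = coord n a j (\<lambda>i. \<Sum>j=1..n. c j * real_of_int (Avec n a j i))"
  proof (rule coord_cong [OF j])
    fix i assume "i \<in> {1..n}"
    then show "real_of_int (p i) = (\<Sum>j=1..n. c j * real_of_int (Avec n a j i))"
      using fun_cong [OF eq, of i] by simp
  qed
  also have "\<dots> = c j * real_of_int s"
    by (rule coord_Avec_comb [OF j])
  finally have *: "real_of_int (coord n a j p) = c j * real_of_int s" .
  have s: "0 < real_of_int s"
    using total_pos by linarith
  have "0 \<le> real_of_int (coord n a j p)"
    unfolding * using c j s by (intro mult_nonneg_nonneg) auto
  then show "0 \<le> coord n a j p"
    by simp
  have "c j * real_of_int s < 1 * real_of_int s"
    using c j s by (intro mult_strict_right_mono) auto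
  then show "coord n a j p < s"
    unfolding * [symmetric] by linarith
next
  assume ext: "p \<in> extensional {1..n}"
    and bounds: "\<forall>j\<in>{1..n}. 0 \<le> coord n a j p \<and> coord n a j p < s"
  have s: "0 < real_of_int s"
    using total_pos by linarith
  \<comment> \<open>The only possible coefficients, by \<open>coord_Avec_comb\<close>.\<close>
  define c where "c j = real_of_int (coord n a j p) / real_of_int s" for j
  have "real_of_int (p i) = (\<Sum>j=1..n. c j * real_of_int (Avec n a j i))" if "i \<in> {1..n}" for i
  proof -
    have "real_of_int s * real_of_int (p i) =
        (\<Sum>j=1..n. real_of_int (coord n a j p) * real_of_int (Avec n a j i))"
      unfolding of_int_mult [symmetric] coord_expansion [OF that] by simp
    then have "real_of_int (p i) =
        (\<Sum>j=1..n. real_of_int (coord n a j p) * real_of_int (Avec n a j i)) / real_of_int s"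
      using s by (simp add: field_simps del: of_int_sum)
    then show ?thesis
      by (simp add: c_def sum_divide_distrib del: of_int_sum)
  qed
  moreover have "0 \<le> c j \<and> c j < 1" if "j \<in> {1..n}" for j
    using bounds that s by (auto simp: c_def simp del: of_int_sum)
  ultimately have "(\<lambda>i\<in>{1..n}. real_of_int (p i)) \<in> parallelepiped n a"
    unfolding parallelepiped_def by (intro CollectI exI [of _ c]) auto
  then show "p \<in> lattice_points n (parallelepiped n a)"
    using ext by (simp add: lattice_points_def PiE_def)
qed

lemma lattice_points_nonneg:
  assumes "p \<in> lattice_points n (parallelepiped n a)" "i \<in> {1..n}"
  shows "0 \<le> p i"
  using assms nonneg_if_coords_nonneg [of p i] by (simp add: lattice_points_iff)

lemma finite_lattice_points: "finite (lattice_points n (parallelepiped n a))"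
proof (rule finite_subset)
  let ?M = "\<lambda>i. \<Sum>j=1..n. Avec n a j i"
  show "lattice_points n (parallelepiped n a) \<subseteq> (\<Pi>\<^sub>E i\<in>{1..n}. {0..?M i})"
  proof
    fix p assume p: "p \<in> lattice_points n (parallelepiped n a)"
    have "p i \<le> ?M i" if i: "i \<in> {1..n}" for i
    proof -
      \<comment> \<open>Coordinates of p lie below s and the generators are nonnegative, so the
        expansion is bounded termwise.\<close>
      have "s * p i \<le> (\<Sum>j=1..n. s * Avec n a j i)"
        unfolding coord_expansion [OF i, of p]
        using p i by (intro sum_mono mult_right_mono Avec_nonneg)
          (auto simp: lattice_points_iff intro: less_imp_le)
      then have "s * p i \<le> s * ?M i"
        by (simp add: sum_distrib_left)
      then show ?thesis
        using total_pos by (simp add: mult_le_cancel_left)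
    qed
    then show "p \<in> (\<Pi>\<^sub>E i\<in>{1..n}. {0..?M i})"
      using p lattice_points_nonneg [OF p] by (simp add: lattice_points_iff PiE_iff)
  qed
qed (simp add: finite_PiE)

text \<open>Exchange argument: B and \<open>{1..j}\<close> have equally many elements outside each
  other, with weights at least \<open>a j\<close> on the side of B and at most \<open>a j\<close> on
  the other.\<close>

lemma initial_sum_le:
  assumes j: "j \<le> n" "1 \<le> j" and B: "B \<subseteq> {1..n}" "card B = j"
  shows "(\<Sum>i=1..j. a i) \<le> (\<Sum>i\<in>B. a i)"
proof -
  have fin: "finite B"
    using B(1) by (rule finite_subset) simp
  have card: "card (B - {1..j}) = card ({1..j} - B)"
    using fin B(2) card_Diff_subset_Int [of B "{1..j}"] card_Diff_subset_Int [of "{1..j}" B]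
    by (simp add: Int_commute)
  have "(\<Sum>i\<in>{1..j} - B. a i) \<le> of_nat (card ({1..j} - B)) * a j"
    using j by (intro sum_bounded_above) (auto intro: a_mono)
  also have "\<dots> \<le> (\<Sum>i\<in>B - {1..j}. a i)"
    unfolding card [symmetric] using j B(1) by (intro sum_bounded_below a_mono) auto
  finally have "(\<Sum>i\<in>{1..j} - B. a i) \<le> (\<Sum>i\<in>B - {1..j}. a i)" .
  moreover have "(\<Sum>i=1..j. a i) = (\<Sum>i\<in>{1..j} - B. a i) + (\<Sum>i\<in>{1..j} \<inter> B. a i)"
    by (subst add.commute, subst sum.Int_Diff [of _ _ B]) auto
  moreover have "(\<Sum>i\<in>B. a i) = (\<Sum>i\<in>B - {1..j}. a i) + (\<Sum>i\<in>B \<inter> {1..j}. a i)"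
    using fin by (subst add.commute, subst sum.Int_Diff [of _ _ "{1..j}"]) auto
  ultimately show ?thesis
    by (simp add: Int_commute)
qed

text \<open>Expanding x with its nonnegative coordinates leaves the claim for each generator. For j
  < n the value is s times the excess of a j-element sum over the initial one; for j = n it is
  s.\<close>

lemma weighted_sum_nonneg:
  fixes x :: "nat \<Rightarrow> int"
  assumes nonneg: "\<And>j. j \<in> {1..n} \<Longrightarrow> 0 \<le> coord n a j x" and \<tau>: "\<tau> permutes {1..n}"
  shows "0 \<le> (\<Sum>i=1..n. a i * x (\<tau> i))"
proof -
  have A: "0 \<le> (\<Sum>i=1..n. a i * Avec n a j (\<tau> i))" if j: "j \<in> {1..n}" for j
  proof (cases "j < n")
    case True
    let ?B = "{i. i \<in> {1..n} \<and> \<tau> i \<le> j}"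
    \<comment> \<open>This bijection shows that \<open>?B\<close> has j elements, as
      \<open>initial_sum_le\<close> requires.\<close>
    have "\<tau> ` ?B = {1..j}"
    proof
      show "\<tau> ` ?B \<subseteq> {1..j}"
      proof (rule image_subsetI)
        fix i assume "i \<in> ?B"
        then show "\<tau> i \<in> {1..j}"
          using permutes_in_image [OF \<tau>, of i] by simp
      qed
      show "{1..j} \<subseteq> \<tau> ` ?B"
      proof
        fix k assume "k \<in> {1..j}"
        then have "k \<in> \<tau> ` {1..n}"
          using True permutes_image [OF \<tau>] by auto
        then show "k \<in> \<tau> ` ?B"
          using \<open>k \<in> {1..j}\<close> by auto
      qed
    qed
    then have "card ?B = j"
      using card_image [of \<tau> ?B] permutes_inj_on [OF \<tau>, of ?B] by simp
    then have "(\<Sum>i=1..j. a i) \<le> (\<Sum>i\<in>?B. a i)"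
      using j by (intro initial_sum_le) auto
    then show ?thesis
      using j True total_pos by (subst weighted_sum_Avec [OF _ \<tau>]) auto
  next
    case False
    then have "Avec n a j (\<tau> i) = 1" if "i \<in> {1..n}" for i
      using that permutes_in_image [OF \<tau>, of i] by (simp add: Avec_def)
    then have "(\<Sum>i=1..n. a i * Avec n a j (\<tau> i)) = s"
      by simp
    then show ?thesis
      using total_pos by simp
  qed
  have "s * (\<Sum>i=1..n. a i * x (\<tau> i)) = (\<Sum>i=1..n. a i * (s * x (\<tau> i)))"
    by (simp add: sum_distrib_left mult_ac)
  also have "\<dots> = (\<Sum>i=1..n. a i * (\<Sum>j=1..n. coord n a j x * Avec n a j (\<tau> i)))"
  proof (rule sum.cong)
    fix i assume "i \<in> {1..n}"
    then have "\<tau> i \<in> {1..n}"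
      using permutes_in_image [OF \<tau>, of i] by simp
    from coord_expansion [OF this, of x]
    show "a i * (s * x (\<tau> i)) = a i * (\<Sum>j=1..n. coord n a j x * Avec n a j (\<tau> i))"
      by (rule arg_cong)
  qed simp
  also have "\<dots> = (\<Sum>i=1..n. \<Sum>j=1..n. coord n a j x * (a i * Avec n a j (\<tau> i)))"
    by (simp add: sum_distrib_left mult_ac)
  also have "\<dots> = (\<Sum>j=1..n. coord n a j x * (\<Sum>i=1..n. a i * Avec n a j (\<tau> i)))"
    by (subst sum.swap) (simp add: sum_distrib_left)
  also have "\<dots> \<ge> 0"
    by (rule sum_nonneg) (rule mult_nonneg_nonneg [OF nonneg A])
  finally show ?thesis
    using total_pos by (simp add: zero_le_mult_iff)
qed

end


section \<open>Decomposition of the cone\<close>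

text \<open>The descents at which p alone misses the strict drop demanded by
  \<open>sorts\<close>.\<close>

definition tied_descents :: "nat \<Rightarrow> (nat \<Rightarrow> nat) \<Rightarrow> (nat \<Rightarrow> int) \<Rightarrow> nat set" where
  "tied_descents n \<pi> p = {i. i \<in> descents n \<pi> \<and> p i = p (i + 1)}"

lemma tied_descents_subset: "tied_descents n \<pi> p \<subseteq> {1..n}"
  by (auto simp: tied_descents_def descents_def)

context cone_weights
begin

text \<open>A_j is taken m_j times, and once more at a tied descent: the shift turns the constraint
  q_j \<ge> 1 into a free m_j.\<close>

definition translate :: "(nat \<Rightarrow> int) \<Rightarrow> (nat \<Rightarrow> nat) \<Rightarrow> (nat \<Rightarrow> nat) \<Rightarrow> nat \<Rightarrow> int" where
  "translate p \<pi> m i =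
    p i + (\<Sum>j=1..n. (int (m j) + of_bool (j \<in> tied_descents n \<pi> p)) * Avec n a j i)"

text \<open>Entry i of the sorted vector goes to position \<open>\<pi> i\<close>, hence the inverse.
  The nesting makes the multiplicities the inner family in \<open>genf_Sigma\<close>.\<close>

definition arrange :: "((nat \<Rightarrow> int) \<times> (nat \<Rightarrow> nat)) \<times> (nat \<Rightarrow> nat) \<Rightarrow> nat \<Rightarrow> int" where
  "arrange = (\<lambda>((p, \<pi>), m). \<lambda>k\<in>{1..n}. translate p \<pi> m (inv \<pi> k))"

abbreviation cone_data :: "(((nat \<Rightarrow> int) \<times> (nat \<Rightarrow> nat)) \<times> (nat \<Rightarrow> nat)) set" where
  "cone_data \<equiv>
    (lattice_points n (parallelepiped n a) \<times> {\<pi>. \<pi> permutes {1..n}}) \<times> ({1..n} \<rightarrow>\<^sub>E UNIV)"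

lemma coord_translate:
  assumes "j \<in> {1..n}"
  shows "coord n a j (translate p \<pi> m) =
    coord n a j p + s * (int (m j) + of_bool (j \<in> tied_descents n \<pi> p))"
proof -
  have "coord n a j (translate p \<pi> m) = coord n a j p + coord n a j
      (\<lambda>i. \<Sum>j=1..n. (int (m j) + of_bool (j \<in> tied_descents n \<pi> p)) * Avec n a j i)"
    unfolding translate_def by (rule coord_add)
  then show ?thesis
    using coord_Avec_comb [OF assms, of "\<lambda>j. int (m j) + of_bool (j \<in> tied_descents n \<pi> p)"]
    by (simp add: mult.commute)
qed

lemma coord_translate_nonneg:
  assumes "p \<in> lattice_points n (parallelepiped n a)" "j \<in> {1..n}"
  shows "0 \<le> coord n a j (translate p \<pi> m)"
proof -
  have "0 \<le> coord n a j p"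
    using assms by (simp add: lattice_points_iff)
  moreover have "0 \<le> s * (int (m j) + of_bool (j \<in> tied_descents n \<pi> p))"
    using total_pos by (intro mult_nonneg_nonneg) auto
  ultimately show ?thesis
    unfolding coord_translate [OF assms(2)] by (rule add_nonneg_nonneg)
qed

section \<open>Arranged cone points lie in L and are sorted by their permutation\<close>

lemma arrange_permuted:
  assumes "\<pi> permutes {1..n}" "i \<in> {1..n}"
  shows "arrange ((p, \<pi>), m) (\<pi> i) = translate p \<pi> m i"
proof -
  have "\<pi> i \<in> {1..n}"
    using assms permutes_in_image [OF assms(1), of i] by simp
  then show ?thesis
    using permutes_inverses(2) [OF assms(1)] by (simp add: arrange_def)
qed

text \<open>Rearranging the result by \<tau> amounts to rearranging the cone point by
  \<open>inv \<pi> \<circ> \<tau>\<close>, so \<open>weighted_sum_nonneg\<close> applies.\<close>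

lemma arrange_in_Lset:
  assumes p: "p \<in> lattice_points n (parallelepiped n a)" and \<pi>: "\<pi> permutes {1..n}"
  shows "arrange ((p, \<pi>), m) \<in> Lset n a"
  unfolding Lset_def
proof (intro CollectI conjI allI impI)
  note nonneg = coord_translate_nonneg [OF p]
  have inv: "inv \<pi> permutes {1..n}"
    using \<pi> by (rule permutes_inv)
  have "0 \<le> translate p \<pi> m (inv \<pi> k)" if "k \<in> {1..n}" for k
  proof (rule nonneg_if_coords_nonneg [OF nonneg])
    show "inv \<pi> k \<in> {1..n}"
      using that permutes_in_image [OF inv, of k] by simp
  qed
  then show "arrange ((p, \<pi>), m) \<in> {1..n} \<rightarrow>\<^sub>E {0..}"
    by (simp add: arrange_def)
  fix \<tau> assume \<tau>: "\<tau> permutes {1..n}"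
  have "0 \<le> (\<Sum>j=1..n. a j * translate p \<pi> m ((inv \<pi> \<circ> \<tau>) j))"
    by (rule weighted_sum_nonneg [OF nonneg permutes_compose [OF \<tau> inv]])
  also have "\<dots> = (\<Sum>j=1..n. a j * arrange ((p, \<pi>), m) (\<tau> j))"
  proof (rule sum.cong)
    fix j assume "j \<in> {1..n}"
    then have "\<tau> j \<in> {1..n}"
      using permutes_in_image [OF \<tau>, of j] by simp
    then show "a j * translate p \<pi> m ((inv \<pi> \<circ> \<tau>) j) = a j * arrange ((p, \<pi>), m) (\<tau> j)"
      by (simp add: arrange_def)
  qed simp
  finally show "0 \<le> (\<Sum>j=1..n. a j * arrange ((p, \<pi>), m) (\<tau> j))" .
qed

text \<open>The drop from position i to i + 1 along \<pi> is the i-th coordinate. At a descent it is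
  positive because of the forced copy of A_i if p is tied there, and because p itself drops
  otherwise.\<close>

lemma sorts_arrange:
  assumes p: "p \<in> lattice_points n (parallelepiped n a)" and \<pi>: "\<pi> permutes {1..n}"
  shows "sorts n \<pi> (arrange ((p, \<pi>), m))"
  unfolding sorts_def
proof (intro conjI ballI impI \<pi>)
  fix i assume i: "i \<in> {1..n-1}"
  then have "i \<in> {1..n}" "i + 1 \<in> {1..n}" "i < n"
    by auto
  then have diff: "arrange ((p, \<pi>), m) (\<pi> i) - arrange ((p, \<pi>), m) (\<pi> (i + 1)) =
      coord n a i (translate p \<pi> m)"
    using arrange_permuted [OF \<pi>, of i] arrange_permuted [OF \<pi>, of "i + 1"]
    by (simp add: coord_def)
  show "arrange ((p, \<pi>), m) (\<pi> (i + 1)) \<le> arrange ((p, \<pi>), m) (\<pi> i)"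
    using diff coord_translate_nonneg [OF p \<open>i \<in> {1..n}\<close>, of \<pi> m] by linarith
  assume desc: "i \<in> descents n \<pi>"
  have "0 < coord n a i (translate p \<pi> m)"
  proof (cases "i \<in> tied_descents n \<pi> p")
    case True
    have "0 < s * (int (m i) + of_bool (i \<in> tied_descents n \<pi> p))"
      using total_pos True by (intro mult_pos_pos) auto
    moreover have "0 \<le> coord n a i p"
      using p \<open>i \<in> {1..n}\<close> by (simp add: lattice_points_iff)
    ultimately show ?thesis
      unfolding coord_translate [OF \<open>i \<in> {1..n}\<close>] by linarith
  next
    case False
    then have "coord n a i p \<noteq> 0"
      using desc \<open>i < n\<close> by (simp add: tied_descents_def coord_def)
    then have "0 < coord n a i p"
      using p \<open>i \<in> {1..n}\<close> by (simp add: lattice_points_iff order_less_le)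
    moreover have "0 \<le> s * (int (m i) + of_bool (i \<in> tied_descents n \<pi> p))"
      using total_pos by (intro mult_nonneg_nonneg) auto
    ultimately show ?thesis
      unfolding coord_translate [OF \<open>i \<in> {1..n}\<close>] by linarith
  qed
  then show "arrange ((p, \<pi>), m) (\<pi> (i + 1)) < arrange ((p, \<pi>), m) (\<pi> i)"
    using diff by linarith
qed

section \<open>The arrangement map is a bijection onto L\<close>

lemma coord_determines:
  fixes x y :: "nat \<Rightarrow> int"
  assumes "\<And>k. k \<in> {1..n} \<Longrightarrow> coord n a k x = coord n a k y" "i \<in> {1..n}"
  shows "x i = y i"
  using coord_eq_0_imp [of "\<lambda>i. x i - y i" i] assms by (simp add: coord_diff)

text \<open>Coordinates of p lie in [0, s), so division by s separates them from the
  multiplicities.\<close>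

lemma coord_translate_mod_div:
  assumes "p \<in> lattice_points n (parallelepiped n a)" "j \<in> {1..n}"
  shows "coord n a j (translate p \<pi> m) mod s = coord n a j p"
    and "coord n a j (translate p \<pi> m) div s = int (m j) + of_bool (j \<in> tied_descents n \<pi> p)"
proof -
  have "0 \<le> coord n a j p" "coord n a j p < s"
    using assms by (simp_all add: lattice_points_iff)
  then show "coord n a j (translate p \<pi> m) mod s = coord n a j p"
    "coord n a j (translate p \<pi> m) div s = int (m j) + of_bool (j \<in> tied_descents n \<pi> p)"
    unfolding coord_translate [OF assms(2)] by simp_all
qed

text \<open>Uniqueness of the sorting permutation recovers \<pi>; remainders of the coordinates
  modulo s then recover p, and quotients recover m.\<close>

lemma inj_on_arrange: "inj_on arrange cone_data"
proof (rule inj_onI)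
  fix z w assume z: "z \<in> cone_data" and w: "w \<in> cone_data" and eq: "arrange z = arrange w"
  obtain p \<pi> m where z_eq: "z = ((p, \<pi>), m)"
    by (metis prod.collapse)
  obtain q \<sigma> k where w_eq: "w = ((q, \<sigma>), k)"
    by (metis prod.collapse)
  have p: "p \<in> lattice_points n (parallelepiped n a)" and \<pi>: "\<pi> permutes {1..n}"
    and m: "m \<in> {1..n} \<rightarrow>\<^sub>E UNIV"
    and q: "q \<in> lattice_points n (parallelepiped n a)" and \<sigma>: "\<sigma> permutes {1..n}"
    and k: "k \<in> {1..n} \<rightarrow>\<^sub>E UNIV"
    using z w by (simp_all add: z_eq w_eq)
  have "\<pi> = \<sigma>"
    using sorts_arrange [OF p \<pi>, of m] sorts_arrange [OF q \<sigma>, of k] ex1_sorts eq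
    unfolding z_eq w_eq by metis
  have "translate p \<pi> m i = translate q \<pi> k i" if "i \<in> {1..n}" for i
    using eq arrange_permuted [OF \<pi> that] unfolding z_eq w_eq \<open>\<pi> = \<sigma>\<close> [symmetric] by metis
  then have coord: "coord n a j (translate p \<pi> m) = coord n a j (translate q \<pi> k)"
    if "j \<in> {1..n}" for j
    using that by (intro coord_cong)
  have "p = q"
  proof (rule extensionalityI [of _ "{1..n}"])
    show "p \<in> extensional {1..n}" "q \<in> extensional {1..n}"
      using p q by (simp_all add: lattice_points_iff)
    show "p i = q i" if "i \<in> {1..n}" for i
    proof (rule coord_determines [OF _ that])
      fix j assume j: "j \<in> {1..n}"
      show "coord n a j p = coord n a j q"
        using coord_translate_mod_div(1) [OF p j, of \<pi> m]
          coord_translate_mod_div(1) [OF q j, of \<pi> k] coord [OF j] by simp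
    qed
  qed
  have "m = k"
  proof (rule extensionalityI [of _ "{1..n}"])
    show "m \<in> extensional {1..n}" "k \<in> extensional {1..n}"
      using m k by (simp_all add: PiE_def)
    fix i assume i: "i \<in> {1..n}"
    \<comment> \<open>With p = q the tied descents agree, so the forced copies cancel in the
      quotients.\<close>
    show "m i = k i"
      using coord_translate_mod_div(2) [OF p i, of \<pi> m]
        coord_translate_mod_div(2) [OF q i, of \<pi> k] coord [OF i] \<open>p = q\<close> by simp
  qed
  then show "z = w"
    by (simp add: z_eq w_eq \<open>p = q\<close> \<open>\<pi> = \<sigma>\<close>)
qed

text \<open>Sort l and divide each coordinate of the sorted vector by s: remainders give p,
  quotients the multiplicities.\<close>

lemma Lset_subset_arrange: "Lset n a \<subseteq> arrange ` cone_data"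
proof
  fix l assume l: "l \<in> Lset n a"
  obtain \<pi> where sorts: "sorts n \<pi> l"
    using ex1_sorts by metis
  then have \<pi>: "\<pi> permutes {1..n}"
    by (simp add: sorts_def)
  define y where "y i = l (\<pi> i)" for i
  have y_nonneg: "0 \<le> coord n a j y" if "j \<in> {1..n}" for j
  proof (cases "j < n")
    case True
    then have "j \<in> {1..n-1}"
      using that by auto
    then have "l (\<pi> (j + 1)) \<le> l (\<pi> j)"
      using sorts by (simp only: sorts_def)
    then show ?thesis
      using True by (simp add: coord_def y_def)
  next
    case False
    \<comment> \<open>Here j = n, and the last coordinate of y is the defining inequality of L for
      \<pi> itself.\<close>
    then show ?thesis
      using l \<pi> by (simp add: coord_def y_def Lset_def)
  qed
  define q where "q j = coord n a j y div s" for j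
  define p where "p = (\<lambda>i\<in>{1..n}. y i - (\<Sum>j=1..n. q j * Avec n a j i))"
  have coord_p: "coord n a j p = coord n a j y mod s" if "j \<in> {1..n}" for j
  proof -
    have "coord n a j p = coord n a j (\<lambda>i. y i - (\<Sum>j=1..n. q j * Avec n a j i))"
      using that by (rule coord_cong) (simp add: p_def)
    also have "\<dots> = coord n a j y - q j * s"
      using coord_Avec_comb [OF that, of q] by (simp add: coord_diff)
    finally show ?thesis
      by (simp add: q_def minus_div_mult_eq_mod)
  qed
  have p: "p \<in> lattice_points n (parallelepiped n a)"
    unfolding lattice_points_iff
  proof (intro conjI ballI)
    show "p \<in> extensional {1..n}"
      by (simp add: p_def)
    fix j assume "j \<in> {1..n}"
    then show "0 \<le> coord n a j p" "coord n a j p < s"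
      using total_pos by (simp_all add: coord_p)
  qed
  have q_ge: "of_bool (j \<in> tied_descents n \<pi> p) \<le> q j" if j: "j \<in> {1..n}" for j
  proof (cases "j \<in> tied_descents n \<pi> p")
    case True
    then have "j \<in> descents n \<pi>" "j \<in> {1..n-1}" "j < n" "p j = p (j + 1)"
      using that by (auto simp: tied_descents_def descents_def)
    then have "0 < coord n a j y"
      using sorts by (simp add: sorts_def coord_def y_def)
    moreover have "coord n a j p = 0"
      using \<open>j < n\<close> \<open>p j = p (j + 1)\<close> by (simp add: coord_def)
    \<comment> \<open>At a tied descent the remainder is 0, so a positive coordinate forces a
      positive quotient.\<close>
    then have "coord n a j y = s * q j"
      using coord_p [OF j] mult_div_mod_eq [of s "coord n a j y"] by (simp add: q_def)
    ultimately have "0 < q j"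
      using total_pos by (simp add: zero_less_mult_iff)
    then show ?thesis
      by simp
  next
    case False
    then show ?thesis
      using y_nonneg [OF j] total_pos by (simp add: q_def pos_imp_zdiv_nonneg_iff)
  qed
  \<comment> \<open>By \<open>q_ge\<close> the argument of \<open>nat\<close> is nonnegative, so
    nothing is truncated.\<close>
  define m where "m = (\<lambda>j\<in>{1..n}. nat (q j - of_bool (j \<in> tied_descents n \<pi> p)))"
  have m: "int (m j) + of_bool (j \<in> tied_descents n \<pi> p) = q j" if "j \<in> {1..n}" for j
    using q_ge [OF that] that by (simp add: m_def)
  have translate: "translate p \<pi> m i = y i" if "i \<in> {1..n}" for i
  proof -
    have "(\<Sum>j=1..n. (int (m j) + of_bool (j \<in> tied_descents n \<pi> p)) * Avec n a j i) =
        (\<Sum>j=1..n. q j * Avec n a j i)"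
      by (rule sum.cong) (simp_all add: m)
    then show ?thesis
      using that by (simp add: translate_def p_def)
  qed
  have "l = arrange ((p, \<pi>), m)"
  proof (rule extensionalityI [of _ "{1..n}"])
    show "l \<in> extensional {1..n}"
      using l by (simp add: Lset_def PiE_def)
    show "arrange ((p, \<pi>), m) \<in> extensional {1..n}"
      by (simp add: arrange_def)
    fix k assume k: "k \<in> {1..n}"
    then have "inv \<pi> k \<in> {1..n}"
      using permutes_in_image [OF permutes_inv [OF \<pi>], of k] by simp
    then show "l k = arrange ((p, \<pi>), m) k"
      using k translate permutes_inverses(1) [OF \<pi>] by (simp add: arrange_def y_def)
  qed
  moreover have "((p, \<pi>), m) \<in> cone_data"
    using p \<pi> by (simp add: m_def)
  ultimately show "l \<in> arrange ` cone_data"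
    by blast
qed

lemma bij_betw_arrange: "bij_betw arrange cone_data (Lset n a)"
proof (rule bij_betw_imageI [OF inj_on_arrange])
  have "arrange ` cone_data \<subseteq> Lset n a"
    using arrange_in_Lset by blast
  then show "arrange ` cone_data = Lset n a"
    using Lset_subset_arrange by (rule antisym)
qed

section \<open>Assembly of the generating function\<close>

lemma expo_translate:
  assumes "p \<in> lattice_points n (parallelepiped n a)"
  shows "expo n \<pi> (translate p \<pi> m) =
    (expo n \<pi> p + (\<Sum>j\<in>tied_descents n \<pi> p. expo n \<pi> (Avec n a j))) +
    (\<Sum>j=1..n. of_nat (m j) * expo n \<pi> (Avec n a j))"
proof -
  let ?T = "tied_descents n \<pi> p"
  have "expo n \<pi> (translate p \<pi> m) =
      expo n \<pi> (\<lambda>i. p i + (\<Sum>j=1..n. int (m j + of_bool (j \<in> ?T)) * Avec n a j i))"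
    by (simp add: translate_def [abs_def])
  \<comment> \<open>Additivity of \<open>expo\<close> rests on the nonnegativity of p and of the
    generators, since \<open>nat\<close> truncates.\<close>
  also have "\<dots> =
      expo n \<pi> p + expo n \<pi> (\<lambda>i. \<Sum>j=1..n. int (m j + of_bool (j \<in> ?T)) * Avec n a j i)"
    by (intro expo_add lattice_points_nonneg [OF assms] sum_nonneg mult_nonneg_nonneg Avec_nonneg)
      auto
  also have "expo n \<pi> (\<lambda>i. \<Sum>j=1..n. int (m j + of_bool (j \<in> ?T)) * Avec n a j i) =
      (\<Sum>j=1..n. expo n \<pi> (\<lambda>i. int (m j + of_bool (j \<in> ?T)) * Avec n a j i))"
    by (intro expo_sum mult_nonneg_nonneg Avec_nonneg) auto
  also have "\<dots> = (\<Sum>j=1..n. of_bool (j \<in> ?T) * expo n \<pi> (Avec n a j)) +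
      (\<Sum>j=1..n. of_nat (m j) * expo n \<pi> (Avec n a j))"
    unfolding expo_scale by (simp add: algebra_simps sum.distrib)
  also have "(\<Sum>j=1..n. of_bool (j \<in> ?T) * expo n \<pi> (Avec n a j)) =
      (\<Sum>j\<in>?T. expo n \<pi> (Avec n a j))"
    using tied_descents_subset by (intro sum.mono_neutral_cong_right) auto
  finally show ?thesis
    by (simp add: add.assoc)
qed

text \<open>For fixed p and \<pi> the exponent is a fixed shift plus a combination of generators
  with free multiplicities, whose series inverts the denominator.\<close>

lemma
  assumes p: "p \<in> lattice_points n (parallelepiped n a)"
  shows finite_fibres_translate:
      "finite_fibres (\<lambda>m. expo n \<pi> (translate p \<pi> m)) ({1..n} \<rightarrow>\<^sub>E UNIV)"
    and summand_eq_genf: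
      "(zpow n \<pi> p * (\<Prod>i\<in>tied_descents n \<pi> p. zpow n \<pi> (Avec n a i))) /
          (\<Prod>j=1..n. 1 - zpow n \<pi> (Avec n a j)) =
        genf (\<lambda>m. expo n \<pi> (translate p \<pi> m)) ({1..n} \<rightarrow>\<^sub>E UNIV)"
proof -
  let ?u = "\<lambda>j. expo n \<pi> (Avec n a j)"
  let ?G = "genf (\<lambda>m. \<Sum>j=1..n. of_nat (m j) * ?u j) ({1..n} \<rightarrow>\<^sub>E UNIV) :: int mfps"
  have zpow: "zpow n \<pi> (Avec n a j) = mfps_monom (?u j)" if "j \<in> {1..n}" for j
    using that by (intro zpow_eq_monom Avec_nonneg)
  have "?u j \<noteq> 0" if "j \<in> {1..n}" for j
    using n_pos Avec_first_pos [OF that] by (intro expo_nonzero [of 1]) auto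
  then have geo: "finite_fibres (\<lambda>m. \<Sum>j=1..n. of_nat (m j) * ?u j) ({1..n} \<rightarrow>\<^sub>E UNIV)"
    "(\<Prod>j=1..n. 1 - mfps_monom (?u j)) * ?G = 1"
    using prod_geometric_monom [of "{1..n}" ?u] by auto
  show "finite_fibres (\<lambda>m. expo n \<pi> (translate p \<pi> m)) ({1..n} \<rightarrow>\<^sub>E UNIV)"
    unfolding expo_translate [OF p] by (rule finite_fibres_shift [OF geo(1)])
  have "(\<Prod>j=1..n. 1 - zpow n \<pi> (Avec n a j)) = (\<Prod>j=1..n. 1 - mfps_monom (?u j))"
    using zpow by (intro prod.cong) auto
  \<comment> \<open>Division is multiplication by \<open>inverse\<close>, whose value is determined
    by a product equal to 1.\<close>
  then have "inverse (\<Prod>j=1..n. 1 - zpow n \<pi> (Avec n a j)) = ?G"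
    using mfps_inverse_unique [OF geo(2)] by simp
  moreover have "(\<Prod>i\<in>tied_descents n \<pi> p. zpow n \<pi> (Avec n a i)) =
      mfps_monom (\<Sum>i\<in>tied_descents n \<pi> p. ?u i)"
    unfolding monom_prod [symmetric]
    using tied_descents_subset by (intro prod.cong zpow) blast+
  moreover have "zpow n \<pi> p = mfps_monom (expo n \<pi> p)"
    using lattice_points_nonneg [OF p] by (rule zpow_eq_monom)
  ultimately show "(zpow n \<pi> p * (\<Prod>i\<in>tied_descents n \<pi> p. zpow n \<pi> (Avec n a i))) /
        (\<Prod>j=1..n. 1 - zpow n \<pi> (Avec n a j)) =
      genf (\<lambda>m. expo n \<pi> (translate p \<pi> m)) ({1..n} \<rightarrow>\<^sub>E UNIV)"
    unfolding divide_mfps_def expo_translate [OF p]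
    by (simp only: monom_mult monom_times_genf [OF geo(1)])
qed

text \<open>\<open>bij_betw_arrange\<close> moves the series of L to \<open>cone_data\<close>;
  grouping by p and \<pi> leaves one geometric series per summand.\<close>

lemma genf_Lset:
  "mfps_sum (zpow n id) (Lset n a) =
    (\<Sum>p\<in>lattice_points n (parallelepiped n a). \<Sum>\<pi> | \<pi> permutes {1..n}.
       (zpow n \<pi> p * (\<Prod>i\<in>tied_descents n \<pi> p. zpow n \<pi> (Avec n a i))) /
       (\<Prod>j=1..n. 1 - zpow n \<pi> (Avec n a j)))"
  (is "_ = (\<Sum>p\<in>?P. \<Sum>\<pi>\<in>?S. ?t p \<pi>)")
proof -
  let ?M = "{1..n} \<rightarrow>\<^sub>E (UNIV :: nat set)"
  let ?\<phi> = "\<lambda>(p, \<pi>) m. expo n \<pi> (translate p \<pi> m)"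
  have "mfps_sum (zpow n id) (Lset n a) = genf (expo n id) (Lset n a)"
    by (rule mfps_sum_zpow) (auto simp: Lset_def PiE_def Pi_def)
  also have "\<dots> = genf (\<lambda>(x, m). ?\<phi> x m) cone_data"
  proof (rule genf_bij_betw [OF bij_betw_arrange, symmetric])
    fix z assume z: "z \<in> cone_data"
    obtain p \<pi> m where z_eq: "z = ((p, \<pi>), m)"
      by (metis prod.collapse)
    have \<pi>: "\<pi> permutes {1..n}"
      using z by (simp add: z_eq)
    \<comment> \<open>Read along \<pi>, the arranged vector is the sorted cone point, so its
      monomial becomes one in the variables z_\<pi>.\<close>
    have "expo n id (arrange z) = expo n \<pi> (\<lambda>i. arrange z (\<pi> i))"
      by (rule expo_permute [OF \<pi>])
    also have "\<dots> = expo n \<pi> (translate p \<pi> m)"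
      by (rule expo_cong) (simp only: z_eq arrange_permuted [OF \<pi>])
    finally show "expo n id (arrange z) = (case z of (x, m) \<Rightarrow> ?\<phi> x m)"
      by (simp add: z_eq)
  qed
  also have "\<dots> = (\<Sum>x\<in>?P \<times> ?S. genf (?\<phi> x) ?M)"
  proof (rule genf_Sigma)
    show "finite (?P \<times> ?S)"
      by (simp add: finite_lattice_points finite_permutations)
    show "finite_fibres (?\<phi> x) ?M" if "x \<in> ?P \<times> ?S" for x
      using that finite_fibres_translate by (cases x) (simp del: One_nat_def)
  qed
  also have "\<dots> = (\<Sum>p\<in>?P. \<Sum>\<pi>\<in>?S. genf (?\<phi> (p, \<pi>)) ?M)"
    by (simp add: sum.cartesian_product case_prod_beta)
  also have "\<dots> = (\<Sum>p\<in>?P. \<Sum>\<pi>\<in>?S. ?t p \<pi>)"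
    by (intro sum.cong refl) (simp only: prod.case summand_eq_genf)
  finally show ?thesis .
qed

end

theorem theorem2:
  fixes n :: nat and a :: "nat \<Rightarrow> int"
  assumes "n \<ge> 1"
    and "\<And>i j. 1 \<le> i \<Longrightarrow> i \<le> j \<Longrightarrow> j \<le> n \<Longrightarrow> a i \<le> a j"
    and "\<And>j. 1 \<le> j \<Longrightarrow> j \<le> n - 1 \<Longrightarrow> (\<Sum>i=1..j. a i) \<le> 0"
    and "(\<Sum>i=1..n. a i) \<ge> 1"
  shows "mfps_sum (zpow n id) (Lset n a) =
    (\<Sum>p\<in>lattice_points n (parallelepiped n a). \<Sum>\<pi> | \<pi> permutes {1..n}.
       (zpow n \<pi> p * (\<Prod>i | i \<in> descents n \<pi> \<and> p i = p (i + 1). zpow n \<pi> (Avec n a i))) /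
       (\<Prod>j=1..n. 1 - zpow n \<pi> (Avec n a j)))"
proof -
  interpret cone_weights n a
    using assms by unfold_locales
  show ?thesis
    using genf_Lset unfolding tied_descents_def .
qed

end
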